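(* The following seven assertions are all equivalent (each one is true if and only if each of the others is true). (a) For every positive integer $N$, every coloring of the edges of the $N$-vertex transitive tournament with three colors contains a directed path with at least $N^{2/3}$ vertices whose edges avoid at least one of the three colors. (b) For every positive integer $N$ and every coloring of the edges of the $N$-vertex transitive tournament with three colors $R,G,B$, if $p_R,p_G,p_B$ denote the maximum numbers of vertices of directed paths having no $R$-colored edge, no $G$-colored edge, and no $B$-colored edge respectively, then $p_R\,p_G\,p_B\ge N^2$. (c) Every ordered set $S\subseteq\mathbb{R}^3$ satisfies $\ell_x\ell_y\ell_z\ge |S|^2$. (d) For all positive integers $n_1,n_2,n_3$, every ordered set $S\subseteq [n_1]\times[n_2]\times[n_3]$ satisfies $|S|\le (n_1n_2n_3)^{1/2}$. (e) Every RGBK-tournament $\mathcal{T}$ satisfies $\ell(RGK)\cdot\ell(RBK)\cdot\ell(GBK)\ge |V(\mathcal{T})|^2$. (f) Every geometric RGBK-tournament $\mathcal{T}$ satisfies $\ell(RGK)\cdot\ell(RBK)\cdot\ell(GBK)\ge |V(\mathcal{T})|^2$. (g) Every canonical RGBK-tournament $\mathcal{T}$ satisfies $\ell(RGK)\cdot\ell(RBK)\cdot\ell(GBK)\ge |V(\mathcal{T})|^2$.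
   Context: $[n]=\{1,\dots,n\}$. The transitive tournament on vertices $v_1,\dots,v_N$ has the directed edges $v_i\to v_j$ for all $i<j$. A finite set $S\subseteq\mathbb{R}^3$ is *ordered* if its elements can be listed as $L_1,\dots,L_{|S|}$ such that for all $i<j$ the difference $L_j-L_i$ has at least two strictly positive coordinates (this listing is unique). For an ordered set and a coordinate $c\in\{x,y,z\}$, $\ell_c$ is the length of the longest subsequence of $L_1,\dots,L_{|S|}$ whose $c$-coordinates are strictly increasing. An *RGBK-tournament* is a transitive tournament on ordered vertices $v_1,\dots,v_N$ with each edge $v_i\to v_j$ ($i<j$) colored one of four colors $R,G,B,K$. A *color class* is a set of colors, written as a string (e.g. $RGK=\{R,G,K\}$). $\ell(C)=\ell_{\mathcal{T}}(C)$ is the maximum number of vertices of a directed path in $\mathcal{T}$ all of whose edges have colors in $C$ (length always counts vertices; a single vertex is a path). $\operatorname{Record}(\mathcal{T})\subseteq\mathbb{Z}_{>0}^3$ is the ordered set whose triples, listed in the order of the vertices, are $(x_v,y_v,z_v)$, where $x_v,y_v,z_v$ are the lengths of the longest $RGK$-, $RBK$-, $GBK$-colored directed paths ending at $v$. For an ordered set $S$ with listing $L_1,\dots,L_{|S|}$, $\operatorname{Color}(S)$ is the RGBK-tournament on $v_1,\dots,v_{|S|}$ in which, for $i<j$, $v_i\to v_j$ is colored according to the sign pattern of $L_j-L_i$: $R$ if $(+,+,\le 0)$, $G$ if $(+,\le 0,+)$, $B$ if $(\le 0,+,+)$, $K$ if $(+,+,+)$, where $+$ means strictly positive. $\operatorname{Dual}(\mathcal{T})$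 is obtained by reversing all edge directions (hence the vertex order) and keeping edge colors. An RGBK-tournament is *geometric* if it equals $\operatorname{Color}(S)$ for some ordered set $S\subseteq\mathbb{R}^3$. It is *canonical* if it is fixed under both $\operatorname{Color}\circ\operatorname{Record}$ and $\operatorname{Dual}\circ\operatorname{Color}\circ\operatorname{Record}\circ\operatorname{Dual}$ (with the natural identification of vertices). *)

theory Defs
  imports "HOL-Analysis.Analysis" "HOL-Library.Sublist"
begin

section \<open>Edge-coloured transitive tournaments\<close>

datatype color = Red | Green | Blue | Black

text \<open>The vertices of \<open>T\<close> are \<open>1, \<dots>, nverts T\<close>, and there is an edge from \<open>i\<close> to \<open>j\<close> exactly when
  \<open>1 \<le> i < j \<le> nverts T\<close>. The values of \<open>edge_color T\<close> elsewhere carry no meaning, so equality of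
  tournaments is \<open>tournament_eq\<close> rather than equality of records.\<close>

record tournament =
  nverts :: nat
  edge_color :: "nat \<Rightarrow> nat \<Rightarrow> color"

definition tournament_eq :: "tournament \<Rightarrow> tournament \<Rightarrow> bool" where
  "tournament_eq T T' \<longleftrightarrow> nverts T = nverts T' \<and>
     (\<forall>i j. 1 \<le> i \<and> i < j \<and> j \<le> nverts T \<longrightarrow> edge_color T i j = edge_color T' i j)"

text \<open>A three-coloured tournament is one in which \<open>Black\<close> does not occur.\<close>

definition RGB_colored :: "tournament \<Rightarrow> bool" where
  "RGB_colored T \<longleftrightarrow>
     (\<forall>i j. 1 \<le> i \<and> i < j \<and> j \<le> nverts T \<longrightarrow> edge_color T i j \<in> {Red, Green, Blue})"

definition colored_path :: "tournament \<Rightarrow> color set \<Rightarrow> nat list \<Rightarrow> bool" where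
  "colored_path T C p \<longleftrightarrow> p \<noteq> [] \<and> set p \<subseteq> {1..nverts T} \<and>
     successively (\<lambda>i j. i < j \<and> edge_color T i j \<in> C) p"

text \<open>If \<open>T\<close> has no vertices then the maximum below is over the empty set and its value is
  unspecified; the bounds considered here are then of the form \<open>\<dots> \<ge> 0\<close>.\<close>

definition longest_path :: "tournament \<Rightarrow> color set \<Rightarrow> nat" where
  "longest_path T C = Max {length p | p. colored_path T C p}"

definition longest_path_to :: "tournament \<Rightarrow> color set \<Rightarrow> nat \<Rightarrow> nat" where
  "longest_path_to T C v = Max {length p | p. colored_path T C p \<and> last p = v}"

definition Dual :: "tournament \<Rightarrow> tournament" where
  "Dual T = \<lparr>nverts = nverts T,
     edge_color = (\<lambda>i j. edge_color T (nverts T + 1 - j) (nverts T + 1 - i))\<rparr>"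

section \<open>Ordered sets in three-dimensional space\<close>

definition precedes :: "real^3 \<Rightarrow> real^3 \<Rightarrow> bool" where
  "precedes p q \<longleftrightarrow> card {c. 0 < (q - p) $ c} \<ge> 2"

definition is_listing :: "(real^3) set \<Rightarrow> (real^3) list \<Rightarrow> bool" where
  "is_listing S L \<longleftrightarrow> set L = S \<and> distinct L \<and> sorted_wrt precedes L"

definition ordered_set :: "(real^3) set \<Rightarrow> bool" where
  "ordered_set S \<longleftrightarrow> finite S \<and> (\<exists>L. is_listing S L)"

definition listing :: "(real^3) set \<Rightarrow> (real^3) list" where
  "listing S = (THE L. is_listing S L)"

lemma precedes_asym:
  assumes "precedes p q" shows "\<not> precedes q p"
proof
  assume "precedes q p"
  let ?A = "{c. 0 < (q - p) $ c}" and ?B = "{c. 0 < (p - q) $ c}"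
  have "card ?A + card ?B = card (?A \<union> ?B)"
    by (rule card_Un_disjoint[symmetric]) auto
  also have "\<dots> \<le> card (UNIV :: 3 set)"
    by (rule card_mono) auto
  finally show False
    using assms \<open>precedes q p\<close> by (simp add: precedes_def)
qed

lemma is_listing_unique:
  assumes "is_listing S L" "is_listing S M" shows "L = M"
  using assms
proof (induction L arbitrary: S M)
  case Nil
  then show ?case by (auto simp: is_listing_def)
next
  case (Cons p L)
  then obtain q N where M: "M = q # N"
    by (cases M) (auto simp: is_listing_def)
  have "p = q"
  proof (rule ccontr)
    assume "p \<noteq> q"
    then have "q \<in> set L" "p \<in> set N"
      using Cons.prems unfolding is_listing_def M by auto
    then have "precedes p q" "precedes q p"
      using Cons.prems unfolding is_listing_def M by auto
    then show False
      using precedes_asym by blast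
  qed
  moreover have "is_listing (S - {p}) L" "is_listing (S - {p}) N"
    using Cons.prems \<open>p = q\<close> unfolding is_listing_def M by auto
  ultimately show ?case
    using Cons.IH M by blast
qed

lemma listing_eqI: "is_listing S L \<Longrightarrow> listing S = L"
  unfolding listing_def by (blast intro: is_listing_unique)

definition longest_increasing :: "3 \<Rightarrow> (real^3) set \<Rightarrow> nat" where
  "longest_increasing c S =
     Max {length M | M. subseq M (listing S) \<and> sorted_wrt (\<lambda>p q. p $ c < q $ c) M}"

definition grid :: "nat \<Rightarrow> nat \<Rightarrow> nat \<Rightarrow> (real^3) set" where
  "grid n1 n2 n3 = {p. p $ 1 \<in> real ` {1..n1} \<and> p $ 2 \<in> real ` {1..n2} \<and> p $ 3 \<in> real ` {1..n3}}"

section \<open>Passing between tournaments and ordered sets\<close>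

text \<open>Differences along the listing of an ordered set have at least two positive coordinates, so the
  last case below is reached there only for the pattern \<open>(+,+,+)\<close>.\<close>

definition sign_color :: "real^3 \<Rightarrow> color" where
  "sign_color d =
     (if 0 < d $ 1 \<and> 0 < d $ 2 \<and> d $ 3 \<le> 0 then Red
      else if 0 < d $ 1 \<and> d $ 2 \<le> 0 \<and> 0 < d $ 3 then Green
      else if d $ 1 \<le> 0 \<and> 0 < d $ 2 \<and> 0 < d $ 3 then Blue
      else Black)"

text \<open>Vertices are numbered from 1, list positions from 0.\<close>

definition Color :: "(real^3) set \<Rightarrow> tournament" where
  "Color S = \<lparr>nverts = card S,
     edge_color = (\<lambda>i j. sign_color (listing S ! (j - 1) - listing S ! (i - 1)))\<rparr>"

definition record_triple :: "tournament \<Rightarrow> nat \<Rightarrow> real^3" where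
  "record_triple T v = vector
     [real (longest_path_to T {Red, Green, Black} v),
      real (longest_path_to T {Red, Blue, Black} v),
      real (longest_path_to T {Green, Blue, Black} v)]"

text \<open>An edge \<open>u \<rightarrow> v\<close> of any colour belongs to two of the three colour classes, so the triples at
  \<open>1, \<dots>, nverts T\<close> are listed in vertex order; this identifies the vertices of \<open>T\<close> with those of
  \<open>Color (Record T)\<close>.\<close>

definition Record :: "tournament \<Rightarrow> (real^3) set" where
  "Record T = record_triple T ` {1..nverts T}"

definition geometric :: "tournament \<Rightarrow> bool" where
  "geometric T \<longleftrightarrow> (\<exists>S. ordered_set S \<and> tournament_eq T (Color S))"

definition canonical :: "tournament \<Rightarrow> bool" where
  "canonical T \<longleftrightarrow> tournament_eq (Color (Record T)) T \<and>
     tournament_eq (Dual (Color (Record (Dual T)))) T"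

section \<open>The seven assertions\<close>

definition path_product_bound :: "tournament \<Rightarrow> bool" where
  "path_product_bound T \<longleftrightarrow>
     longest_path T {Red, Green, Black} * longest_path T {Red, Blue, Black}
       * longest_path T {Green, Blue, Black} \<ge> (nverts T)\<^sup>2"

definition assertion_a :: bool where
  "assertion_a \<longleftrightarrow>
     (\<forall>N T. N > 0 \<and> nverts T = N \<and> RGB_colored T \<longrightarrow>
        (\<exists>p. \<exists>c\<in>{Red, Green, Blue}. colored_path T (- {c}) p \<and>
           real (length p) \<ge> real N powr (2 / 3)))"

definition assertion_b :: bool where
  "assertion_b \<longleftrightarrow>
     (\<forall>N T. N > 0 \<and> nverts T = N \<and> RGB_colored T \<longrightarrow>
        longest_path T (- {Red}) * longest_path T (- {Green}) * longest_path T (- {Blue}) \<ge> N\<^sup>2)"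

definition assertion_c :: bool where
  "assertion_c \<longleftrightarrow>
     (\<forall>S. ordered_set S \<longrightarrow>
        longest_increasing 1 S * longest_increasing 2 S * longest_increasing 3 S \<ge> (card S)\<^sup>2)"

definition assertion_d :: bool where
  "assertion_d \<longleftrightarrow>
     (\<forall>n1 n2 n3 S. n1 > 0 \<and> n2 > 0 \<and> n3 > 0 \<and> ordered_set S \<and> S \<subseteq> grid n1 n2 n3 \<longrightarrow>
        real (card S) \<le> real (n1 * n2 * n3) powr (1 / 2))"

definition assertion_e :: bool where
  "assertion_e \<longleftrightarrow> (\<forall>T. path_product_bound T)"

definition assertion_f :: bool where
  "assertion_f \<longleftrightarrow> (\<forall>T. geometric T \<longrightarrow> path_product_bound T)"

definition assertion_g :: bool where
  "assertion_g \<longleftrightarrow> (\<forall>T. canonical T \<longrightarrow> path_product_bound T)"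

end

theory Submission
  imports Defs
begin

text \<open>
  The common tool is the following duality for longest paths: the \<open>C\<close>-coloured paths of \<open>T\<close> have at
  most \<open>m\<close> vertices exactly if the vertices can be labelled by \<open>1, \<dots>, m\<close> so that labels strictly
  increase along edges with colours in \<open>C\<close> (\<open>longest_path_le_iff_labelling\<close>). The labels obtained from
  a tournament are the lengths of the longest paths ending at each vertex, which are the coordinates
  of its record.

  Assertions (c) to (f) form a cycle, in which (f) is a special case of (e). Paths of \<open>Color S\<close> in a colour class are subsequences of the
  listing of \<open>S\<close> that increase in one coordinate, so (f) gives (c). In a grid such a subsequence is no
  longer than the side of the grid, so (c) gives (d). The record of \<open>T\<close> is an ordered set of
  \<open>nverts T\<close> points in the grid whose sides are the three path lengths of \<open>T\<close>, so (d) gives (e).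

  For (g) implies (e), consider the operations \<open>Color \<circ> Record\<close> and its conjugate under \<open>Dual\<close>. Neither
  lengthens any of the three longest paths, because the coordinates of the record still label the new
  tournament; and along an edge the record increases in every coordinate whose colour class contains
  the colour of the edge, so an edge either keeps its colour or becomes black. Hence the number of
  non-black edges drops until both operations act trivially, and the bound for the canonical
  tournament so reached implies the bound for \<open>T\<close>.

  Black edges do not matter for (e): turning them all red removes edges from the class
  \<open>{Green, Blue, Black}\<close> and leaves the other two classes unchanged. This is the equivalence of (b) and
  (e). Finally (b) gives (a) since the largest of three factors is at least their geometric mean. For
  the converse, (a) is applied to the lexicographic product of the three cyclic recolourings of \<open>T\<close>. It
  has \<open>N\<^sup>3\<close> vertices, and path lengths are submultiplicative under such products, so avoiding any
  colour allows at most \<open>p\<^sub>R p\<^sub>G p\<^sub>B\<close> vertices; thus \<open>p\<^sub>R p\<^sub>G p\<^sub>B \<ge> (N\<^sup>3) powr (2/3) = N\<^sup>2\<close>.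
\<close>

section \<open>Path lengths through vertex labellings\<close>

abbreviation is_edge :: "tournament \<Rightarrow> nat \<Rightarrow> nat \<Rightarrow> bool" where
  "is_edge T i j \<equiv> 1 \<le> i \<and> i < j \<and> j \<le> nverts T"

definition labelling :: "tournament \<Rightarrow> color set \<Rightarrow> nat \<Rightarrow> (nat \<Rightarrow> nat) \<Rightarrow> bool" where
  "labelling T C m f \<longleftrightarrow> (\<forall>v\<in>{1..nverts T}. f v \<in> {1..m}) \<and>
     (\<forall>i j. is_edge T i j \<and> edge_color T i j \<in> C \<longrightarrow> f i < f j)"

lemma length_strict_sorted_le_card:
  fixes xs :: "'a::linorder list"
  assumes "sorted_wrt (<) xs" "set xs \<subseteq> A" "finite A"
  shows "length xs \<le> card A"
  using assms by (metis card_mono distinct_card strict_sorted_iff)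

text \<open>The labels along a path are strictly increasing elements of \<open>{1..m}\<close>.\<close>

lemma length_colored_path_le_labelling:
  assumes "labelling T C m f" "colored_path T C p"
  shows "length p \<le> m"
proof -
  have "successively (\<lambda>i j. f i < f j) p"
    by (rule successively_mono[of "\<lambda>i j. i < j \<and> edge_color T i j \<in> C"])
      (use assms in \<open>auto simp: colored_path_def labelling_def subset_iff\<close>)
  then have "sorted_wrt (<) (map f p)"
    by (simp add: successively_map flip: successively_conv_sorted_wrt)
  moreover have "set (map f p) \<subseteq> {1..m}"
    using assms by (auto simp: colored_path_def labelling_def)
  ultimately have "length (map f p) \<le> card {1..m}"
    by (rule length_strict_sorted_le_card) simp
  then show ?thesis by simp
qed

text \<open>With the preceding bound this shows that the set of path lengths is finite, so that \<open>Max\<close> in the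
  definition of \<open>longest_path\<close> bounds all of them.\<close>

lemma labelling_id: "labelling T C (nverts T) id"
  by (auto simp: labelling_def)

lemma finite_colored_path_lengths: "finite {length p | p. colored_path T C p}"
  by (rule finite_subset[of _ "{..nverts T}"])
    (auto dest: length_colored_path_le_labelling[OF labelling_id])

lemma colored_path_singleton: "v \<in> {1..nverts T} \<Longrightarrow> colored_path T C [v]"
  by (simp add: colored_path_def)

lemma length_le_longest_path: "colored_path T C p \<Longrightarrow> length p \<le> longest_path T C"
  unfolding longest_path_def by (rule Max_ge[OF finite_colored_path_lengths]) auto

lemma longest_path_attained:
  assumes "nverts T > 0"
  obtains p where "colored_path T C p" "length p = longest_path T C"
proof -
  have "longest_path T C \<in> {length p | p. colored_path T C p}"
    unfolding longest_path_def
  proof (rule Max_in[OF finite_colored_path_lengths])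
    have "colored_path T C [1]"
      using assms by (intro colored_path_singleton) auto
    then show "{length p | p. colored_path T C p} \<noteq> {}" by blast
  qed
  then show ?thesis using that by auto
qed

lemma finite_colored_path_to_lengths:
  "finite {length p | p. colored_path T C p \<and> last p = v}"
  by (rule finite_subset[OF _ finite_colored_path_lengths]) auto

lemma length_le_longest_path_to:
  "colored_path T C p \<Longrightarrow> length p \<le> longest_path_to T C (last p)"
  unfolding longest_path_to_def by (rule Max_ge[OF finite_colored_path_to_lengths]) auto

lemma longest_path_to_attained:
  assumes "v \<in> {1..nverts T}"
  obtains p where "colored_path T C p" "last p = v" "length p = longest_path_to T C v"
proof -
  have "longest_path_to T C v \<in> {length p | p. colored_path T C p \<and> last p = v}"
    unfolding longest_path_to_def
    by (rule Max_in[OF finite_colored_path_to_lengths])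
      (use colored_path_singleton[OF assms] in \<open>auto intro!: exI[of _ "[v]"]\<close>)
  then show ?thesis using that by auto
qed

text \<open>A longest path ending at \<open>i\<close> can be prolonged by any edge \<open>i \<rightarrow> j\<close> with colour in \<open>C\<close>.\<close>

lemma labelling_longest_path_to:
  "labelling T C (longest_path T C) (longest_path_to T C)"
  unfolding labelling_def
proof (intro conjI ballI allI impI)
  fix v assume v: "v \<in> {1..nverts T}"
  then obtain p where p: "colored_path T C p" "length p = longest_path_to T C v"
    by (elim longest_path_to_attained[where C = C])
  then have "p \<noteq> []" by (simp add: colored_path_def)
  then have "1 \<le> length p" by (cases p) auto
  then show "longest_path_to T C v \<in> {1..longest_path T C}"
    using length_le_longest_path[OF p(1)] p(2) by auto
next
  fix i j assume ij: "is_edge T i j \<and> edge_color T i j \<in> C"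
  then have "i \<in> {1..nverts T}" by auto
  then obtain p where p: "colored_path T C p" "last p = i" "length p = longest_path_to T C i"
    by (elim longest_path_to_attained[where C = C])
  have "colored_path T C (p @ [j])"
    using p ij by (auto simp: colored_path_def successively_append_iff)
  from length_le_longest_path_to[OF this] show "longest_path_to T C i < longest_path_to T C j"
    using p(3) by simp
qed

lemma longest_path_le_iff_labelling:
  assumes "nverts T > 0"
  shows "longest_path T C \<le> m \<longleftrightarrow> (\<exists>f. labelling T C m f)"
proof
  assume "longest_path T C \<le> m"
  then have "labelling T C m (longest_path_to T C)"
    using labelling_longest_path_to[of T C] by (force simp: labelling_def)
  then show "\<exists>f. labelling T C m f" by blast
next
  assume "\<exists>f. labelling T C m f"
  then show "longest_path T C \<le> m"
    using length_colored_path_le_labelling longest_path_attained[OF assms] by metis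
qed

section \<open>Coordinates and colour classes\<close>

text \<open>In \<open>Color S\<close> these are the colours of the edges along which coordinate \<open>c\<close> increases. Indexing
  by coordinates allows a single argument for the three classes \<open>RGK\<close>, \<open>RBK\<close> and \<open>GBK\<close>.\<close>

definition coord_colors :: "3 \<Rightarrow> color set" where
  "coord_colors c =
     (if c = 1 then {Red, Green, Black} else if c = 2 then {Red, Blue, Black}
      else {Green, Blue, Black})"

lemma coord_colors_simps [simp]:
  "coord_colors 1 = {Red, Green, Black}"
  "coord_colors 2 = {Red, Blue, Black}"
  "coord_colors 3 = {Green, Blue, Black}"
  by (simp_all add: coord_colors_def)

lemma all_color: "(\<forall>k. P k) \<longleftrightarrow> P Red \<and> P Green \<and> P Blue \<and> P Black"
  by (metis color.exhaust)

lemma coord_colors_eq_Compl: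
  "coord_colors 1 = - {Blue}" "coord_colors 2 = - {Green}" "coord_colors 3 = - {Red}"
  by (simp_all add: set_eq_iff all_color)

lemma path_product_bound_coord:
  "path_product_bound T \<longleftrightarrow> (nverts T)\<^sup>2 \<le> longest_path T (coord_colors 1)
     * longest_path T (coord_colors 2) * longest_path T (coord_colors 3)"
  by (simp add: path_product_bound_def)

lemma path_product_bound_mono:
  assumes "path_product_bound T'" "nverts T' = nverts T"
    and "\<And>c. longest_path T' (coord_colors c) \<le> longest_path T (coord_colors c)"
  shows "path_product_bound T"
  unfolding path_product_bound_coord
  by (rule order_trans[OF _ mult_le_mono[OF mult_le_mono]])
    (use assms in \<open>simp_all only: path_product_bound_coord\<close>)

lemma precedes_iff:
  "precedes p q \<longleftrightarrow> p $ 1 < q $ 1 \<and> p $ 2 < q $ 2 \<or> p $ 1 < q $ 1 \<and> p $ 3 < q $ 3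
     \<or> p $ 2 < q $ 2 \<and> p $ 3 < q $ 3"
proof -
  have "{c. 0 < (q - p) $ c} = (if p $ 1 < q $ 1 then {1} else {}) \<union>
      (if p $ 2 < q $ 2 then {2} else {}) \<union> (if p $ 3 < q $ 3 then {3} else {})"
    by (auto simp: set_eq_iff forall_3)
  then show ?thesis
    by (simp add: precedes_def)
qed

lemma sign_color_mem_coord_colors_iff:
  assumes "precedes p q"
  shows "sign_color (q - p) \<in> coord_colors c \<longleftrightarrow> p $ c < q $ c"
  using assms exhaust_3[of c] by (auto simp: precedes_iff sign_color_def)

text \<open>Red, green and blue each lie in a different pair of the three classes, and only black lies
  in all of them, so enlarging the set of classes containing a colour can only produce black.\<close>

lemma color_eq_or_Black:
  assumes "\<And>c. k \<in> coord_colors c \<Longrightarrow> k' \<in> coord_colors c"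
  shows "k' = k \<or> k' = Black"
  using assms[of 1] assms[of 2] assms[of 3] by (cases k; cases k'; simp)

section \<open>Tournaments of ordered sets\<close>

lemma is_listing_listing: "ordered_set S \<Longrightarrow> is_listing S (listing S)"
  by (metis ordered_set_def listing_eqI)

lemma length_listing: "ordered_set S \<Longrightarrow> length (listing S) = card S"
  by (metis is_listing_listing is_listing_def distinct_card)

lemma nverts_Color [simp]: "nverts (Color S) = card S"
  by (simp add: Color_def)

lemma edge_color_Color_mem_iff:
  assumes "ordered_set S" "is_edge (Color S) i j"
  shows "edge_color (Color S) i j \<in> coord_colors c \<longleftrightarrow>
    listing S ! (i - 1) $ c < listing S ! (j - 1) $ c"
proof -
  have "precedes (listing S ! (i - 1)) (listing S ! (j - 1))"
    using is_listing_listing[OF assms(1)] length_listing[OF assms(1)] assms(2)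
    by (intro sorted_wrt_nth_less[of precedes "listing S"]) (auto simp: is_listing_def)
  then show ?thesis
    by (simp add: Color_def sign_color_mem_coord_colors_iff)
qed

lemma finite_increasing_lengths:
  "finite {length M | M. subseq M L \<and> sorted_wrt r M}"
  by (rule finite_subset[of _ "{..length L}"]) (auto dest: list_emb_length)

text \<open>A path of \<open>Color S\<close> picks out a subsequence of the listing, and the chosen coordinate
  increases from each of its vertices to the next. The empty set is excluded because \<open>longest_path\<close>
  is unspecified there.\<close>

lemma longest_path_Color_le_longest_increasing:
  assumes S: "ordered_set S" and "S \<noteq> {}"
  shows "longest_path (Color S) (coord_colors c) \<le> longest_increasing c S"
proof -
  let ?L = "listing S" and ?n = "card S"
  have "finite S" using S by (simp add: ordered_set_def)
  then have "nverts (Color S) > 0" using \<open>S \<noteq> {}\<close> by (simp add: card_gt_0_iff)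
  then obtain p where p: "colored_path (Color S) (coord_colors c) p"
      "length p = longest_path (Color S) (coord_colors c)"
    by (rule longest_path_attained)
  define M where "M = map (\<lambda>i. ?L ! (i - 1)) p"
  have sub: "set p \<subseteq> {1..?n}"
    using p by (simp add: colored_path_def)
  have "successively (<) p"
    using p(1) unfolding colored_path_def by (auto elim: successively_mono)
  then have "sorted_wrt (<) p"
    by (simp add: successively_conv_sorted_wrt)
  then have "p = filter (\<lambda>i. i \<in> set p) [1..<Suc ?n]"
    using sub by (intro sorted_distinct_set_unique)
      (auto simp: strict_sorted_iff simp del: upt_Suc intro: sorted_wrt_filter)
  then have "subseq p [1..<Suc ?n]"
    by (metis subseq_filter_left)
  then have "subseq M (map (\<lambda>i. ?L ! (i - 1)) [1..<Suc ?n])"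
    unfolding M_def by (rule subseq_map)
  moreover have "map (\<lambda>i. ?L ! (i - 1)) [1..<Suc ?n] = ?L"
    using length_listing[OF S] by (intro nth_equalityI) (auto simp del: upt_Suc)
  moreover have "sorted_wrt (\<lambda>p q. p $ c < q $ c) M"
  proof -
    have "successively (\<lambda>i j. ?L ! (i - 1) $ c < ?L ! (j - 1) $ c) p"
      by (rule successively_mono[of "\<lambda>i j. i < j \<and> edge_color (Color S) i j \<in> coord_colors c"])
        (use p(1) edge_color_Color_mem_iff[OF S] in \<open>auto simp: colored_path_def subset_iff\<close>)
    moreover have "transp (\<lambda>p q :: real^3. p $ c < q $ c)"
      by (auto intro: transpI)
    ultimately show ?thesis
      by (simp add: M_def successively_map flip: successively_conv_sorted_wrt)
  qed
  ultimately have "length M \<in> {length M | M. subseq M ?L \<and> sorted_wrt (\<lambda>p q. p $ c < q $ c) M}"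
    by auto
  then have "length M \<le> longest_increasing c S"
    unfolding longest_increasing_def by (rule Max_ge[OF finite_increasing_lengths])
  then show ?thesis
    using p(2) by (simp add: M_def)
qed

text \<open>The \<open>c\<close>-coordinates along such a subsequence are distinct members of a set of \<open>n\<close> numbers.\<close>

lemma longest_increasing_le:
  assumes S: "ordered_set S" and range: "\<And>p. p \<in> S \<Longrightarrow> p $ c \<in> real ` {1..n}"
  shows "longest_increasing c S \<le> n"
proof -
  let ?A = "{length M | M. subseq M (listing S) \<and> sorted_wrt (\<lambda>p q. p $ c < q $ c) M}"
  have "length M \<le> n" if M: "subseq M (listing S)" "sorted_wrt (\<lambda>p q. p $ c < q $ c) M" for M
  proof -
    have "set M \<subseteq> S"
      using M(1) is_listing_listing[OF S] by (auto simp: is_listing_def dest: list_emb_set)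
    then have "set (map (\<lambda>p. p $ c) M) \<subseteq> real ` {1..n}"
      using range by auto
    then have "length (map (\<lambda>p. p $ c) M) \<le> card (real ` {1..n})"
      using M(2) by (intro length_strict_sorted_le_card) (auto simp: sorted_wrt_map)
    then show ?thesis
      by (simp add: card_image)
  qed
  moreover have "?A \<noteq> {}"
    by (auto intro: exI[of _ "[]"])
  ultimately show ?thesis
    unfolding longest_increasing_def by (subst Max_le_iff[OF finite_increasing_lengths]) auto
qed

section \<open>The record of a tournament\<close>

lemma record_triple_nth:
  "record_triple T v $ c = real (longest_path_to T (coord_colors c) v)"
  using exhaust_3[of c] by (auto simp: record_triple_def)

lemma record_triple_less:
  assumes "is_edge T i j" "edge_color T i j \<in> coord_colors c"
  shows "record_triple T i $ c < record_triple T j $ c"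
  using labelling_longest_path_to[of T "coord_colors c"] assms
  by (simp add: record_triple_nth labelling_def)

text \<open>Every colour lies in at least two of the three classes, and the record increases along the
  edge in the corresponding coordinates.\<close>

lemma precedes_record_triple:
  assumes "is_edge T i j"
  shows "precedes (record_triple T i) (record_triple T j)"
  using record_triple_less[OF assms, of 1] record_triple_less[OF assms, of 2]
    record_triple_less[OF assms, of 3]
  by (cases "edge_color T i j") (auto simp: precedes_iff)

lemma is_listing_Record: "is_listing (Record T) (map (record_triple T) [1..<Suc (nverts T)])"
proof -
  let ?L = "map (record_triple T) [1..<Suc (nverts T)]"
  have "sorted_wrt precedes ?L"
    by (auto simp: sorted_wrt_iff_nth_less simp del: upt_Suc intro!: precedes_record_triple)
  moreover have "distinct ?L"
    unfolding distinct_conv_nth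
  proof (intro allI impI)
    fix i j assume ij: "i < length ?L" "j < length ?L" "i \<noteq> j"
    then have "precedes (?L ! i) (?L ! j) \<or> precedes (?L ! j) (?L ! i)"
      using \<open>sorted_wrt precedes ?L\<close> by (metis linorder_neqE_nat sorted_wrt_iff_nth_less)
    then show "?L ! i \<noteq> ?L ! j"
      using precedes_asym by metis
  qed
  ultimately show ?thesis
    by (auto simp: is_listing_def Record_def simp del: upt_Suc)
qed

lemma ordered_set_Record: "ordered_set (Record T)"
  using is_listing_Record by (auto simp: ordered_set_def Record_def)

lemma card_Record: "card (Record T) = nverts T"
  using is_listing_Record[of T] distinct_card[of "map (record_triple T) [1..<Suc (nverts T)]"]
  by (simp add: is_listing_def del: upt_Suc)

lemma Record_subset_grid:
  "Record T \<subseteq> grid (longest_path T (coord_colors 1)) (longest_path T (coord_colors 2))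
     (longest_path T (coord_colors 3))"
  using labelling_longest_path_to[of T] unfolding labelling_def
  by (auto simp: Record_def grid_def record_triple_nth simp del: coord_colors_simps)

lemma edge_color_Color_Record:
  assumes "is_edge T i j"
  shows "edge_color (Color (Record T)) i j = sign_color (record_triple T j - record_triple T i)"
proof -
  have "i - 1 < nverts T" "j - 1 < nverts T" using assms by auto
  then show ?thesis
    using assms by (simp add: Color_def listing_eqI[OF is_listing_Record] del: upt_Suc)
qed

text \<open>An edge of \<open>Color (Record T)\<close> has its colour in the class of \<open>c\<close> exactly if the \<open>c\<close>-coordinate of
  the record, a longest path length of \<open>T\<close>, increases along it; so these lengths label the new
  tournament within the old range.\<close>

lemma longest_path_Color_Record_le:
  assumes "nverts T > 0"
  shows "longest_path (Color (Record T)) (coord_colors c) \<le> longest_path T (coord_colors c)"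
proof -
  have "labelling (Color (Record T)) (coord_colors c) (longest_path T (coord_colors c))
      (longest_path_to T (coord_colors c))"
    using labelling_longest_path_to[of T "coord_colors c"]
    by (auto simp: labelling_def card_Record edge_color_Color_Record record_triple_nth
        sign_color_mem_coord_colors_iff[OF precedes_record_triple])
  then show ?thesis
    using assms by (auto simp: longest_path_le_iff_labelling card_Record)
qed

section \<open>Reaching a canonical tournament\<close>

definition blackens :: "tournament \<Rightarrow> tournament \<Rightarrow> bool" where
  "blackens T' T \<longleftrightarrow> nverts T' = nverts T \<and>
     (\<forall>i j. is_edge T i j \<longrightarrow> edge_color T' i j \<in> {edge_color T i j, Black})"

lemma blackens_Color_Record: "blackens (Color (Record T)) T"
proof -
  have "edge_color (Color (Record T)) i j = edge_color T i j \<or>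
      edge_color (Color (Record T)) i j = Black" if "is_edge T i j" for i j
    by (rule color_eq_or_Black)
      (use that in \<open>simp add: edge_color_Color_Record sign_color_mem_coord_colors_iff
        precedes_record_triple record_triple_less\<close>)
  then show ?thesis
    by (simp add: blackens_def card_Record)
qed

lemma nverts_Dual [simp]: "nverts (Dual T) = nverts T"
  by (simp add: Dual_def)

lemma edge_color_Dual:
  "edge_color (Dual T) i j = edge_color T (nverts T + 1 - j) (nverts T + 1 - i)"
  by (simp add: Dual_def)

lemma blackens_Dual_left:
  assumes "blackens T' (Dual T)"
  shows "blackens (Dual T') T"
  unfolding blackens_def
proof (intro conjI allI impI)
  show n: "nverts (Dual T') = nverts T"
    using assms by (simp add: blackens_def)
  fix i j assume ij: "is_edge T i j"
  let ?i = "nverts T + 1 - j" and ?j = "nverts T + 1 - i"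
  have "is_edge (Dual T) ?i ?j"
    using ij by auto
  then have "edge_color T' ?i ?j \<in> {edge_color (Dual T) ?i ?j, Black}"
    using assms unfolding blackens_def by blast
  then show "edge_color (Dual T') i j \<in> {edge_color T i j, Black}"
    using ij n by (simp add: edge_color_Dual)
qed

text \<open>Reversing both the vertex order and the label range turns a labelling of \<open>T\<close> into one of
  \<open>Dual T\<close>.\<close>

lemma longest_path_Dual_le:
  assumes "nverts T > 0"
  shows "longest_path (Dual T) C \<le> longest_path T C"
proof -
  let ?m = "longest_path T C" and ?n = "nverts T" and ?f = "longest_path_to T C"
  have f: "labelling T C ?m ?f"
    by (rule labelling_longest_path_to)
  have "labelling (Dual T) C ?m (\<lambda>v. ?m + 1 - ?f (?n + 1 - v))"
    unfolding labelling_def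
  proof (intro conjI ballI allI impI)
    fix v assume "v \<in> {1..nverts (Dual T)}"
    then have "?n + 1 - v \<in> {1..?n}" by auto
    then have "?f (?n + 1 - v) \<in> {1..?m}"
      using f by (auto simp: labelling_def)
    then show "?m + 1 - ?f (?n + 1 - v) \<in> {1..?m}" by auto
  next
    fix i j assume ij: "is_edge (Dual T) i j \<and> edge_color (Dual T) i j \<in> C"
    then have "is_edge T (?n + 1 - j) (?n + 1 - i)" by auto
    then have "?f (?n + 1 - j) < ?f (?n + 1 - i)" "?f (?n + 1 - i) \<le> ?m"
      using f ij by (auto simp: labelling_def edge_color_Dual)
    then show "?m + 1 - ?f (?n + 1 - i) < ?m + 1 - ?f (?n + 1 - j)" by linarith
  qed
  then show ?thesis
    using assms by (auto simp: longest_path_le_iff_labelling)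
qed

definition nonblack_edges :: "tournament \<Rightarrow> (nat \<times> nat) set" where
  "nonblack_edges T = {(i, j). is_edge T i j \<and> edge_color T i j \<noteq> Black}"

text \<open>Blackening is irreversible, so the number of non-black edges is a termination measure.\<close>

lemma card_nonblack_edges_less:
  assumes "blackens T' T" "\<not> tournament_eq T' T"
  shows "card (nonblack_edges T') < card (nonblack_edges T)"
proof (rule psubset_card_mono)
  show "finite (nonblack_edges T)"
    by (rule finite_subset[of _ "{1..nverts T} \<times> {1..nverts T}"])
      (auto simp: nonblack_edges_def)
  show "nonblack_edges T' \<subset> nonblack_edges T"
    using assms by (fastforce simp: nonblack_edges_def blackens_def tournament_eq_def)
qed

text \<open>A tournament that is not canonical is changed by one of the two operations, which then
  yields fewer non-black edges, as many vertices and no longer paths; the bound for the result is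
  therefore stronger than the bound for the tournament itself.\<close>

lemma path_product_bound_if_canonical:
  assumes "\<And>T. canonical T \<Longrightarrow> path_product_bound T"
  shows "path_product_bound T"
proof (induction "card (nonblack_edges T)" arbitrary: T rule: less_induct)
  case less
  show ?case
  proof (cases "canonical T \<or> nverts T = 0")
    case True
    then show ?thesis using assms by (auto simp: path_product_bound_def)
  next
    case False
    then have n: "nverts T > 0" by simp
    let ?\<Phi> = "\<lambda>T. Color (Record T)"
    obtain T' where T': "blackens T' T" "\<not> tournament_eq T' T"
      "\<And>c. longest_path T' (coord_colors c) \<le> longest_path T (coord_colors c)"
    proof (cases "tournament_eq (?\<Phi> T) T")
      case False
      then show ?thesis
        using that blackens_Color_Record longest_path_Color_Record_le[OF n] by blast
    next
      case True
      then have "\<not> tournament_eq (Dual (?\<Phi> (Dual T))) T"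
        using \<open>\<not> (canonical T \<or> nverts T = 0)\<close> by (simp add: canonical_def)
      moreover have "blackens (Dual (?\<Phi> (Dual T))) T"
        by (intro blackens_Dual_left blackens_Color_Record)
      moreover have "longest_path (Dual (?\<Phi> (Dual T))) (coord_colors c)
          \<le> longest_path T (coord_colors c)" for c
      proof -
        have "longest_path (Dual (?\<Phi> (Dual T))) (coord_colors c)
            \<le> longest_path (?\<Phi> (Dual T)) (coord_colors c)"
          using n by (intro longest_path_Dual_le) (simp add: card_Record)
        also have "\<dots> \<le> longest_path (Dual T) (coord_colors c)"
          using n by (intro longest_path_Color_Record_le) simp
        also have "\<dots> \<le> longest_path T (coord_colors c)"
          using n by (rule longest_path_Dual_le)
        finally show ?thesis .
      qed
      ultimately show ?thesis using that by blast
    qed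
    have "path_product_bound T'"
      using T' by (intro less card_nonblack_edges_less)
    then show ?thesis
      by (rule path_product_bound_mono) (use T' in \<open>simp_all only: blackens_def\<close>)
  qed
qed

section \<open>Recolouring and lexicographic products\<close>

definition recolor :: "(color \<Rightarrow> color) \<Rightarrow> tournament \<Rightarrow> tournament" where
  "recolor h T = \<lparr>nverts = nverts T, edge_color = (\<lambda>i j. h (edge_color T i j))\<rparr>"

lemma nverts_recolor [simp]: "nverts (recolor h T) = nverts T"
  by (simp add: recolor_def)

lemma edge_color_recolor [simp]: "edge_color (recolor h T) i j = h (edge_color T i j)"
  by (simp add: recolor_def)

lemma longest_path_recolor: "longest_path (recolor h T) C = longest_path T (h -` C)"
  by (simp add: longest_path_def colored_path_def)

lemma longest_path_mono:
  assumes "nverts T > 0" "C \<subseteq> D"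
  shows "longest_path T C \<le> longest_path T D"
proof -
  have "labelling T C (longest_path T D) (longest_path_to T D)"
    using labelling_longest_path_to[of T D] assms(2) unfolding labelling_def by blast
  then show ?thesis
    using longest_path_le_iff_labelling[OF assms(1)] by blast
qed

text \<open>Each vertex of \<open>T\<close> is replaced by a copy of \<open>U\<close>. Vertex \<open>v\<close> stands for the pair of the quotient
  and the remainder of \<open>v - 1\<close> modulo \<open>nverts U\<close>, each shifted by one since vertices are numbered
  from 1; this enumerates the pairs in lexicographic order.\<close>

definition lex_product :: "tournament \<Rightarrow> tournament \<Rightarrow> tournament" where
  "lex_product T U = \<lparr>nverts = nverts T * nverts U,
     edge_color = (\<lambda>i j.
       let a = (i - 1) div nverts U; b = (j - 1) div nverts U in
       if a = b then edge_color U ((i - 1) mod nverts U + 1) ((j - 1) mod nverts U + 1)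
       else edge_color T (a + 1) (b + 1))\<rparr>"

lemma nverts_lex_product [simp]: "nverts (lex_product T U) = nverts T * nverts U"
  by (simp add: lex_product_def)

lemma lex_product_vertex:
  assumes "v \<in> {1..nverts (lex_product T U)}"
  shows "(v - 1) div nverts U + 1 \<in> {1..nverts T}" "(v - 1) mod nverts U + 1 \<in> {1..nverts U}"
proof -
  have v: "v - 1 < nverts T * nverts U" using assms by auto
  then have "nverts U > 0" by (cases "nverts U") auto
  then show "(v - 1) mod nverts U + 1 \<in> {1..nverts U}" by (simp add: Suc_le_eq)
  show "(v - 1) div nverts U + 1 \<in> {1..nverts T}"
    using v by (simp add: Suc_le_eq less_mult_imp_div_less)
qed

lemma lex_product_edge_cases:
  assumes "is_edge (lex_product T U) i j"
  obtains
    (base) "is_edge T ((i - 1) div nverts U + 1) ((j - 1) div nverts U + 1)"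
      "edge_color (lex_product T U) i j =
        edge_color T ((i - 1) div nverts U + 1) ((j - 1) div nverts U + 1)"
  | (fibre) "(i - 1) div nverts U = (j - 1) div nverts U"
      "is_edge U ((i - 1) mod nverts U + 1) ((j - 1) mod nverts U + 1)"
      "edge_color (lex_product T U) i j =
        edge_color U ((i - 1) mod nverts U + 1) ((j - 1) mod nverts U + 1)"
proof (cases "(i - 1) div nverts U = (j - 1) div nverts U")
  case True
  have "i - 1 < j - 1" using assms by auto
  then have "(i - 1) mod nverts U < (j - 1) mod nverts U"
    using True by (metis div_mult_mod_eq nat_add_left_cancel_less)
  moreover have "(j - 1) mod nverts U + 1 \<in> {1..nverts U}"
    using assms by (intro lex_product_vertex) auto
  ultimately show ?thesis
    using True by (intro fibre) (auto simp: lex_product_def)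
next
  case False
  have "(i - 1) div nverts U \<le> (j - 1) div nverts U"
    using assms by (intro div_le_mono) auto
  moreover have "(j - 1) div nverts U + 1 \<in> {1..nverts T}"
    using assms by (intro lex_product_vertex) auto
  ultimately show ?thesis
    using False by (intro base) (auto simp: lex_product_def)
qed

text \<open>If \<open>f\<close> labels \<open>T\<close> by \<open>1, \<dots>, m\<close> and \<open>g\<close> labels \<open>U\<close> by \<open>1, \<dots>, k\<close>, then the rank of
  \<open>(f a, g b)\<close> in the lexicographic order of \<open>{1..m} \<times> {1..k}\<close> labels the pair \<open>(a, b)\<close>.\<close>

lemma longest_path_lex_product_le:
  assumes "nverts T > 0" "nverts U > 0"
  shows "longest_path (lex_product T U) C \<le> longest_path T C * longest_path U C"
proof -
  let ?f = "longest_path_to T C" and ?g = "longest_path_to U C"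
  let ?m = "longest_path T C" and ?k = "longest_path U C"
  let ?a = "\<lambda>v. (v - 1) div nverts U + 1" and ?b = "\<lambda>v. (v - 1) mod nverts U + 1"
  have f: "labelling T C ?m ?f" and g: "labelling U C ?k ?g"
    by (rule labelling_longest_path_to)+
  have "labelling (lex_product T U) C (?m * ?k) (\<lambda>v. (?f (?a v) - 1) * ?k + ?g (?b v))"
    unfolding labelling_def
  proof (intro conjI ballI allI impI)
    fix v assume v: "v \<in> {1..nverts (lex_product T U)}"
    have fg: "?f (?a v) \<in> {1..?m}" "?g (?b v) \<in> {1..?k}"
      using f g lex_product_vertex[OF v] unfolding labelling_def by blast+
    then have "(?f (?a v) - 1) * ?k + ?g (?b v) \<le> (?f (?a v) - 1) * ?k + ?k" by simp
    also have "\<dots> = ?f (?a v) * ?k"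
      using fg(1) by (cases "?f (?a v)") auto
    also have "\<dots> \<le> ?m * ?k"
      using fg(1) by (intro mult_right_mono) auto
    finally show "(?f (?a v) - 1) * ?k + ?g (?b v) \<in> {1..?m * ?k}"
      using fg(2) by auto
  next
    fix i j assume ij: "is_edge (lex_product T U) i j \<and> edge_color (lex_product T U) i j \<in> C"
    then have "i \<in> {1..nverts (lex_product T U)}" "j \<in> {1..nverts (lex_product T U)}" by auto
    note V = lex_product_vertex[OF this(1)] lex_product_vertex[OF this(2)]
    have fi: "?f (?a i) \<ge> 1" and gi: "?g (?b i) \<le> ?k" and gj: "?g (?b j) \<ge> 1"
      using f g V unfolding labelling_def by (meson atLeastAtMost_iff)+
    from ij have "is_edge (lex_product T U) i j" by blast
    then show "(?f (?a i) - 1) * ?k + ?g (?b i) < (?f (?a j) - 1) * ?k + ?g (?b j)"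
    proof (cases rule: lex_product_edge_cases)
      case base
      then have "?f (?a i) < ?f (?a j)"
        using f ij unfolding labelling_def by simp
      have "(?f (?a i) - 1) * ?k + ?g (?b i) \<le> (?f (?a i) - 1 + 1) * ?k"
        using gi by simp
      also have "\<dots> \<le> (?f (?a j) - 1) * ?k"
        using fi \<open>?f (?a i) < ?f (?a j)\<close> by (intro mult_right_mono) linarith+
      also have "\<dots> < (?f (?a j) - 1) * ?k + ?g (?b j)"
        using gj by simp
      finally show ?thesis .
    next
      case fibre
      then have "?g (?b i) < ?g (?b j)"
        using g ij unfolding labelling_def by simp
      then show ?thesis using fibre(1) by simp
    qed
  qed
  then show ?thesis
    using assms by (auto simp: longest_path_le_iff_labelling)
qed

lemma RGB_colored_lex_product:
  assumes "RGB_colored T" "RGB_colored U"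
  shows "RGB_colored (lex_product T U)"
  unfolding RGB_colored_def
proof (intro allI impI)
  fix i j assume "is_edge (lex_product T U) i j"
  then show "edge_color (lex_product T U) i j \<in> {Red, Green, Blue}"
    by (cases rule: lex_product_edge_cases) (use assms in \<open>auto simp: RGB_colored_def\<close>)
qed

fun rotate_color :: "color \<Rightarrow> color" where
  "rotate_color Red = Green"
| "rotate_color Green = Blue"
| "rotate_color Blue = Red"
| "rotate_color Black = Black"

lemma vimage_rotate_color:
  "rotate_color -` (- {Red}) = - {Blue}"
  "rotate_color -` (- {Green}) = - {Red}"
  "rotate_color -` (- {Blue}) = - {Green}"
  by (simp_all add: set_eq_iff all_color)

lemma RGB_colored_rotate: "RGB_colored T \<Longrightarrow> RGB_colored (recolor rotate_color T)"
  unfolding RGB_colored_def by fastforce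

section \<open>The equivalences\<close>

text \<open>The three factors of the product are \<open>T\<close> with its colours permuted cyclically, so the bounds for
  avoiding \<open>c\<close> in the three factors are the bounds for avoiding each of the three colours in \<open>T\<close>, for
  every choice of \<open>c\<close>.\<close>

lemma assertion_a_imp_b:
  assumes assertion_a
  shows assertion_b
  unfolding assertion_b_def
proof (intro allI impI)
  fix N T assume T: "N > 0 \<and> nverts T = N \<and> RGB_colored T"
  let ?rot = "recolor rotate_color"
  let ?P = "longest_path T (- {Red}) * longest_path T (- {Green}) * longest_path T (- {Blue})"
  define U where "U = lex_product (lex_product T (?rot T)) (?rot (?rot T))"
  have n: "nverts T > 0" using T by simp
  have nU: "nverts U = N ^ 3"
    using T by (simp add: U_def power3_eq_cube)
  have "RGB_colored U"
    unfolding U_def using T by (intro RGB_colored_lex_product RGB_colored_rotate) auto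
  then obtain p c where p: "c \<in> {Red, Green, Blue}" "colored_path U (- {c}) p"
      "real (length p) \<ge> real (N ^ 3) powr (2 / 3)"
    using assms T nU unfolding assertion_a_def by (meson zero_less_power)
  have "length p \<le> longest_path U (- {c})"
    using p(2) by (rule length_le_longest_path)
  also have "\<dots> \<le> longest_path (lex_product T (?rot T)) (- {c}) * longest_path (?rot (?rot T)) (- {c})"
    unfolding U_def using n by (intro longest_path_lex_product_le) auto
  also have "\<dots> \<le> longest_path T (- {c}) * longest_path (?rot T) (- {c}) *
      longest_path (?rot (?rot T)) (- {c})"
    using n by (intro mult_right_mono longest_path_lex_product_le) auto
  also have "\<dots> = ?P"
    using p(1) by (auto simp: longest_path_recolor vimage_rotate_color)
  finally have "real (length p) \<le> real ?P" by (rule of_nat_mono)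
  moreover have "real (N ^ 3) powr (2 / 3) = real (N\<^sup>2)"
  proof -
    have "real (N ^ 3) = real N powr 3" using T by (simp add: powr_numeral)
    then have "real (N ^ 3) powr (2 / 3) = real N powr 2" by (simp only: powr_powr) simp
    then show ?thesis using T by (simp add: powr_numeral)
  qed
  ultimately have "real (N\<^sup>2) \<le> real ?P" using p(3) by linarith
  then show "?P \<ge> N\<^sup>2" by (simp only: of_nat_le_iff)
qed

lemma assertion_b_imp_a:
  assumes assertion_b
  shows assertion_a
  unfolding assertion_a_def
proof (intro allI impI)
  fix N T assume T: "N > 0 \<and> nverts T = N \<and> RGB_colored T"
  let ?l = "\<lambda>c. longest_path T (- {c})" and ?x = "real N powr (2 / 3)"
  have prod: "N\<^sup>2 \<le> ?l Red * ?l Green * ?l Blue"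
    using assms T unfolding assertion_b_def by blast
  have "\<exists>c\<in>{Red, Green, Blue}. ?x \<le> real (?l c)"
  proof (rule ccontr)
    assume "\<not> ?thesis"
    then have less: "real (?l Red) < ?x" "real (?l Green) < ?x" "real (?l Blue) < ?x"
      by auto
    have "real (?l Red) * real (?l Green) * real (?l Blue) < ?x * ?x * ?x"
      using less by (intro mult_strict_mono mult_nonneg_nonneg mult_pos_pos) (use T in auto)
    also have "?x * ?x * ?x = real N powr 2"
      by (simp flip: powr_add)
    also have "\<dots> = real (N\<^sup>2)" using T by (simp add: powr_numeral)
    finally have "real (?l Red * ?l Green * ?l Blue) < real (N\<^sup>2)" by simp
    then show False using prod by (simp only: of_nat_less_iff)
  qed
  then obtain c where c: "c \<in> {Red, Green, Blue}" "?x \<le> real (?l c)" by blast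
  have "nverts T > 0" using T by simp
  then obtain p where "colored_path T (- {c}) p" "length p = ?l c"
    by (rule longest_path_attained)
  then show "\<exists>p. \<exists>c\<in>{Red, Green, Blue}. colored_path T (- {c}) p \<and> ?x \<le> real (length p)"
    using c by metis
qed

text \<open>Avoiding one of red, green and blue is the same as using one of the classes
  \<open>coord_colors c\<close>, so (b) is the restriction of (e) to tournaments without black edges.\<close>

lemma assertion_e_imp_b:
  assumes assertion_e
  shows assertion_b
  using assms unfolding assertion_b_def assertion_e_def path_product_bound_coord
    coord_colors_eq_Compl by (simp add: mult_ac)

text \<open>Black edges are recoloured red. A class of the form \<open>coord_colors c\<close> contains black, so an edge
  that lies in it after the recolouring already did so before.\<close>

lemma assertion_b_imp_e:
  assumes assertion_b
  shows assertion_e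
  unfolding assertion_e_def
proof
  fix T
  show "path_product_bound T"
  proof (cases "nverts T = 0")
    case True
    then show ?thesis by (simp add: path_product_bound_def)
  next
    case False
    then have n: "nverts T > 0" by simp
    define h where "h k = (if k = Black then Red else k)" for k
    have "h k \<in> {Red, Green, Blue}" for k
      by (cases k) (simp_all add: h_def)
    then have "RGB_colored (recolor h T)"
      unfolding RGB_colored_def edge_color_recolor by blast
    then have "(nverts (recolor h T))\<^sup>2 \<le> longest_path (recolor h T) (- {Red})
        * longest_path (recolor h T) (- {Green}) * longest_path (recolor h T) (- {Blue})"
      using assms n unfolding assertion_b_def by (metis nverts_recolor)
    then have "path_product_bound (recolor h T)"
      unfolding path_product_bound_coord coord_colors_eq_Compl by (simp add: mult_ac)
    moreover have "longest_path (recolor h T) (coord_colors c) \<le> longest_path T (coord_colors c)" for c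
    proof -
      have "h -` coord_colors c \<subseteq> coord_colors c"
        using exhaust_3[of c] by (auto simp: h_def split: if_splits)
      then show ?thesis
        unfolding longest_path_recolor by (rule longest_path_mono[OF n])
    qed
    ultimately show ?thesis
      by (rule path_product_bound_mono[OF _ nverts_recolor])
  qed
qed

lemma assertion_f_imp_c:
  assumes assertion_f
  shows assertion_c
  unfolding assertion_c_def
proof (intro allI impI)
  fix S assume S: "ordered_set S"
  show "(card S)\<^sup>2 \<le> longest_increasing 1 S * longest_increasing 2 S * longest_increasing 3 S"
  proof (cases "S = {}")
    case False
    have "geometric (Color S)"
      using S by (auto simp: geometric_def tournament_eq_def)
    then have "path_product_bound (Color S)"
      using assms by (simp add: assertion_f_def)
    then have "(card S)\<^sup>2 \<le> longest_path (Color S) (coord_colors 1)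
        * longest_path (Color S) (coord_colors 2) * longest_path (Color S) (coord_colors 3)"
      by (simp only: path_product_bound_coord nverts_Color)
    also have "\<dots> \<le> longest_increasing 1 S * longest_increasing 2 S * longest_increasing 3 S"
      by (intro mult_le_mono longest_path_Color_le_longest_increasing S False)
    finally show ?thesis .
  qed simp
qed

lemma assertion_c_imp_d:
  assumes assertion_c
  shows assertion_d
  unfolding assertion_d_def
proof (intro allI impI)
  fix n1 n2 n3 S
  assume H: "n1 > 0 \<and> n2 > 0 \<and> n3 > 0 \<and> ordered_set S \<and> S \<subseteq> grid n1 n2 n3"
  then have "(card S)\<^sup>2 \<le> longest_increasing 1 S * longest_increasing 2 S * longest_increasing 3 S"
    using assms by (simp add: assertion_c_def)
  also have "\<dots> \<le> n1 * n2 * n3"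
    using H by (intro mult_le_mono longest_increasing_le) (auto simp: grid_def)
  finally have "(real (card S))\<^sup>2 \<le> real (n1 * n2 * n3)"
    by (metis of_nat_le_iff of_nat_power)
  then have "real (card S) \<le> sqrt (real (n1 * n2 * n3))"
    by (rule real_le_rsqrt)
  then show "real (card S) \<le> real (n1 * n2 * n3) powr (1 / 2)"
    by (simp add: powr_half_sqrt)
qed

text \<open>The record of \<open>T\<close> has one point for each vertex, and its coordinates are bounded by the three
  path lengths of \<open>T\<close>.\<close>

lemma assertion_d_imp_e:
  assumes assertion_d
  shows assertion_e
  unfolding assertion_e_def
proof
  fix T
  let ?l = "\<lambda>c. longest_path T (coord_colors c)"
  show "path_product_bound T"
  proof (cases "nverts T = 0")
    case True
    then show ?thesis by (simp add: path_product_bound_def)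
  next
    case False
    then have "colored_path T C [1]" for C
      by (intro colored_path_singleton) auto
    then have "?l c > 0" for c
      using length_le_longest_path[of T "coord_colors c" "[1]"] by simp
    then have "real (card (Record T)) \<le> real (?l 1 * ?l 2 * ?l 3) powr (1 / 2)"
      using assms ordered_set_Record Record_subset_grid unfolding assertion_d_def by blast
    then have "real (nverts T) \<le> sqrt (real (?l 1 * ?l 2 * ?l 3))"
      by (simp only: card_Record powr_half_sqrt of_nat_0_le_iff)
    then have "(real (nverts T))\<^sup>2 \<le> (sqrt (real (?l 1 * ?l 2 * ?l 3)))\<^sup>2"
      by (intro power_mono) auto
    also have "\<dots> = real (?l 1 * ?l 2 * ?l 3)"
      by (rule real_sqrt_pow2) (rule of_nat_0_le_iff)
    finally show ?thesis
      unfolding path_product_bound_coord by (metis of_nat_le_iff of_nat_power)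
  qed
qed

theorem theorem1p47:
  "(assertion_a \<longleftrightarrow> assertion_b) \<and> (assertion_b \<longleftrightarrow> assertion_c) \<and> (assertion_c \<longleftrightarrow> assertion_d) \<and>
   (assertion_d \<longleftrightarrow> assertion_e) \<and> (assertion_e \<longleftrightarrow> assertion_f) \<and> (assertion_f \<longleftrightarrow> assertion_g)"
proof -
  have "assertion_e \<Longrightarrow> assertion_f" "assertion_e \<Longrightarrow> assertion_g"
    by (simp_all add: assertion_e_def assertion_f_def assertion_g_def)
  moreover have "assertion_g \<Longrightarrow> assertion_e"
    using path_product_bound_if_canonical by (auto simp: assertion_e_def assertion_g_def)
  ultimately show ?thesis
    using assertion_a_imp_b assertion_b_imp_a assertion_b_imp_e assertion_e_imp_b
      assertion_f_imp_c assertion_c_imp_d assertion_d_imp_e by blast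
qed

end
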